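(* The Gieser transform $G$ on the set of lines in $Pic\,S_7$ and the Bertini transform $B$ on the set of lines in $Pic\,S_8$ can be extended to a symmetry of the Gosset polytope $3_{21}$ and of the Gosset polytope $4_{21}$, respectively. Furthermore, $G$ (respectively $B$) acts on each set of subsimplexes (i.e. for each $k$, on the set of $k$-simplexes) of $3_{21}$ (respectively $4_{21}$) and on the set of $6$-crosspolytopes of $3_{21}$ (respectively the set of $7$-crosspolytopes of $4_{21}$).
   Context: For $r=7,8$, $S_r$ is a del Pezzo surface obtained by blowing up $\mathbb{P}^2$ at $r$ points in general position. $Pic\,S_r=\mathbb{Z}h\oplus\mathbb{Z}e_1\oplus\dots\oplus\mathbb{Z}e_r$ with $h^2=1$, $h\cdot e_i=0$, $e_i\cdot e_j=-\delta_{ij}$, and $K_{S_r}=-3h+\sum_{i=1}^r e_i$. Lines: $L_r=\{l\in Pic\,S_r\mid l^2=l\cdot K_{S_r}=-1\}$. The Gieser transform on lines in $S_7$ is $G(l)=-(K_{S_7}+l)$ for $l\in L_7$; the Bertini transform on lines in $S_8$ is $B(l)=-(2K_{S_8}+l)$ for $l\in L_8$. They are extended to linear combinations of lines by $G(a_1l_1+\dots+a_ml_m)=a_1G(l_1)+\dots+a_mG(l_m)$, and similarly for $B$. The Gosset polytope $(r-4)_{21}$ ($3_{21}$ for $r=7$, $4_{21}$ for $r=8$) is the $r$-dimensional semiregular polytope with symmetry group the Coxeter group $E_r$, realized as the convex hull of $L_r$ in $\{D\in Pic\,S_r\otimes\mathbb{Q}\mid -D\cdot K_{S_r}=1\}$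 with the Euclidean metric given by minus the intersection form; its vertices are exactly the elements of $L_r$. Its proper faces are regular $k$-simplexes ($0\le k\le r-1$) and $(r-1)$-crosspolytopes. *)

theory Defs
  imports "HOL-Analysis.Analysis"
begin

(* The pair (a, b) stands for the class a h + (SUM i. b_i e_i) in Pic S_r, where r = CARD('r).
   With 'a = int this is the Picard lattice itself, with 'a = real its extension of scalars,
   in which the polytope lives. *)
type_synonym ('a, 'r) pic = "'a \<times> ('a, 'r) vec"

definition hyp :: "('a::comm_ring_1, 'r::finite) pic" where
  "hyp = (1, 0)"

definition exc :: "'r \<Rightarrow> ('a::comm_ring_1, 'r::finite) pic" where
  "exc i = (0, axis i 1)"

definition intersection ::
    "('a::comm_ring_1, 'r::finite) pic \<Rightarrow> ('a, 'r) pic \<Rightarrow> 'a" (infixl "\<cdot>" 70) where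
  "D \<cdot> D' = fst D * fst D' - (\<Sum>i\<in>UNIV. snd D $ i * snd D' $ i)"

lemma intersection_basis:
  shows "(hyp :: ('a::comm_ring_1, 'r::finite) pic) \<cdot> hyp = 1"
    and "(hyp :: ('a, 'r) pic) \<cdot> exc i = 0"
    and "(exc i :: ('a, 'r) pic) \<cdot> exc j = (if i = j then -1 else 0)"
proof -
  have "(\<Sum>k\<in>UNIV. axis i (1::'a) $ k * axis j 1 $ k) = (\<Sum>k\<in>UNIV. if k = i then (if i = j then 1 else 0) else 0)"
    by (rule sum.cong) (auto simp: axis_def)
  then show "(exc i :: ('a, 'r) pic) \<cdot> exc j = (if i = j then -1 else 0)"
    by (simp add: intersection_def exc_def)
qed (simp_all add: intersection_def hyp_def exc_def)

definition canonical :: "('a::comm_ring_1, 'r::finite) pic" where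
  "canonical = - (hyp + hyp + hyp) + (\<Sum>i\<in>UNIV. exc i)"

definition lines :: "(int, 'r::finite) pic set" where
  "lines = {l. l \<cdot> l = -1 \<and> l \<cdot> canonical = -1}"

definition gieser :: "(int, 7) pic \<Rightarrow> (int, 7) pic" where
  "gieser l = - (canonical + l)"

definition bertini :: "(int, 8) pic \<Rightarrow> (int, 8) pic" where
  "bertini l = - ((canonical + canonical) + l)"

definition to_real :: "(int, 'r::finite) pic \<Rightarrow> (real, 'r) pic" where
  "to_real D = (of_int (fst D), \<chi> i. of_int (snd D $ i))"

(* The rule T(a_1 l_1 + ... + a_m l_m) = a_1 T(l_1) + ... + a_m T(l_m); the coefficient
   of a line in the combination is given by the function a. *)
definition extends_linearly ::
    "((int, 'r::finite) pic \<Rightarrow> (int, 'r) pic) \<Rightarrow> ((real, 'r) pic \<Rightarrow> (real, 'r) pic) \<Rightarrow> bool" where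
  "extends_linearly T g \<longleftrightarrow>
     (\<forall>A a. finite A \<and> A \<subseteq> lines \<longrightarrow>
        g (\<Sum>l\<in>A. a l *\<^sub>R to_real l) = (\<Sum>l\<in>A. a l *\<^sub>R to_real (T l)))"

definition gosset_space :: "(real, 'r::finite) pic set" where
  "gosset_space = {D. - (D \<cdot> canonical) = 1}"

(* For CARD('r) <= 8 the form is negative definite on the orthogonal complement of the canonical
   class, so this is a Euclidean metric on gosset_space. It is not the metric dist which the
   product type carries as an instance. *)
definition gosset_dist :: "(real, 'r::finite) pic \<Rightarrow> (real, 'r) pic \<Rightarrow> real" where
  "gosset_dist x y = sqrt (- ((x - y) \<cdot> (x - y)))"

definition gosset_polytope :: "(real, 'r::finite) pic set" where
  "gosset_polytope = convex hull (to_real ` lines)"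

definition gosset_symmetry :: "((real, 'r::finite) pic \<Rightarrow> (real, 'r) pic) \<Rightarrow> bool" where
  "gosset_symmetry g \<longleftrightarrow>
     g ` gosset_space = gosset_space \<and>
     (\<forall>x\<in>gosset_space. \<forall>y\<in>gosset_space. gosset_dist (g x) (g y) = gosset_dist x y) \<and>
     g ` gosset_polytope = gosset_polytope"

definition regular_simplex :: "nat \<Rightarrow> (real, 'r::finite) pic set \<Rightarrow> bool" where
  "regular_simplex k S \<longleftrightarrow>
     (\<exists>C s. \<not> affine_dependent C \<and> card C = k + 1 \<and> S = convex hull C \<and>
        (\<forall>x\<in>C. \<forall>y\<in>C. x \<noteq> y \<longrightarrow> gosset_dist x y = s))"

(* Convex hull of the 2n points c + v_i, c - v_i, where the v_i are pairwise orthogonal and of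
   equal nonzero length for minus the intersection form. *)
definition regular_crosspolytope :: "nat \<Rightarrow> (real, 'r::finite) pic set \<Rightarrow> bool" where
  "regular_crosspolytope n S \<longleftrightarrow>
     (\<exists>c v s. s > 0 \<and> (\<forall>i<n. \<forall>j<n. - (v i \<cdot> v j) = (if i = j then s else 0)) \<and>
        S = convex hull ((\<lambda>i. c + v i) ` {..<n} \<union> (\<lambda>i. c - v i) ` {..<n}))"

definition gosset_simplexes :: "nat \<Rightarrow> (real, 'r::finite) pic set set" where
  "gosset_simplexes k = {F. F face_of gosset_polytope \<and> regular_simplex k F}"

definition gosset_crosspolytopes :: "nat \<Rightarrow> (real, 'r::finite) pic set set" where
  "gosset_crosspolytopes n = {F. F face_of gosset_polytope \<and> regular_crosspolytope n F}"

definition acts_on :: "('a \<Rightarrow> 'a) \<Rightarrow> 'a set set \<Rightarrow> bool" where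
  "acts_on g X \<longleftrightarrow> bij_betw (\<lambda>F. g ` F) X X"

end

theory Submission
  imports Defs
begin

text \<open>
  Let \<open>K\<close> be the canonical class. Since \<open>K \<cdot> K = 9 - r\<close> is not zero for \<open>r = 7, 8\<close>, there is
  the linear map \<open>\<iota>\<close> that fixes \<open>K\<close> and is \<open>-1\<close> on the orthogonal complement of \<open>K\<close>, namely
  \<open>\<iota> D = (2 (D \<cdot> K) / (K \<cdot> K)) K - D\<close>. On a line \<open>l\<close>, where \<open>l \<cdot> K = -1\<close>, it takes the value
  \<open>- (c K + l)\<close> with \<open>c = 2 / (K \<cdot> K)\<close>. This is the Gieser transform for \<open>r = 7\<close>, where
  \<open>c = 1\<close>, and the Bertini transform for \<open>r = 8\<close>, where \<open>c = 2\<close>. So both transforms are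
  restrictions of the same geometric map, and both extend linearly.

  The map \<open>\<iota>\<close> is an involution and preserves the intersection form and \<open>K\<close>, hence also the
  affine hyperplane of the polytope and its metric. Lines are singled out among the integral
  classes by intersection numbers with themselves and with \<open>K\<close>; as \<open>\<iota>\<close> sends lines to integral
  classes, it permutes the lines, and therefore maps their convex hull onto itself
  (\<open>canonical_involution_symmetry\<close>).

  The statement about faces holds for every linear automorphism of the form that preserves the
  polytope: faces, regular simplexes and regular crosspolytopes are all described in terms of
  convexity and the form (\<open>acts_on_gosset_simplexes\<close>, \<open>acts_on_gosset_crosspolytopes\<close>).
\<close>

section \<open>The intersection form\<close>

lemma intersection_commute: "D \<cdot> E = E \<cdot> D"
  by (simp add: intersection_def mult.commute)

lemma intersection_diff_left: "(D - D') \<cdot> E = D \<cdot> E - D' \<cdot> E"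
  by (simp add: intersection_def algebra_simps sum_subtractf sum.distrib)

lemma intersection_diff_right: "E \<cdot> (D - D') = E \<cdot> D - E \<cdot> D'"
  using intersection_diff_left by (metis intersection_commute)

lemma intersection_add_left: "(D + D') \<cdot> E = D \<cdot> E + D' \<cdot> E"
  by (simp add: intersection_def algebra_simps sum.distrib)

lemma intersection_scaleR_left: "(a *\<^sub>R D) \<cdot> E = a * (D \<cdot> E)"
  by (simp add: intersection_def algebra_simps sum_distrib_left)

lemma intersection_scaleR_right: "E \<cdot> (a *\<^sub>R D) = a * (E \<cdot> D)"
  using intersection_scaleR_left by (metis intersection_commute)

lemma canonical_coordinates:
  "canonical = ((-3, \<chi> i. 1) :: ('a::comm_ring_1, 'r::finite) pic)"
proof -
  have "(\<Sum>i\<in>UNIV. exc i :: ('a, 'r) pic) = (0, \<chi> i. 1)"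
    by (simp add: exc_def prod_eq_iff fst_sum snd_sum vec_eq_iff axis_def)
  then show ?thesis
    by (simp add: canonical_def hyp_def)
qed

lemma canonical_self_intersection:
  "(canonical :: ('a::comm_ring_1, 'r::finite) pic) \<cdot> canonical = 9 - of_nat CARD('r)"
  by (simp add: canonical_coordinates intersection_def)

lemma to_real_intersection: "to_real D \<cdot> to_real E = of_int (D \<cdot> E)"
  by (simp add: to_real_def intersection_def)

lemma to_real_canonical: "to_real canonical = canonical"
  by (simp add: to_real_def canonical_coordinates)

lemma to_real_add: "to_real (D + E) = to_real D + to_real E"
  by (simp add: to_real_def vec_eq_iff)

lemma to_real_minus: "to_real (- D) = - to_real D"
  by (simp add: to_real_def vec_eq_iff)

text \<open>Membership in \<open>lines\<close> is read off from the real form, so that a real isometry which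
  fixes the canonical class can only send a line to a line or to a non-integral class.\<close>

lemma lines_iff_to_real:
  "l \<in> lines \<longleftrightarrow> to_real l \<cdot> to_real l = -1 \<and> to_real l \<cdot> canonical = -1"
proof -
  have "to_real l \<cdot> canonical = of_int (l \<cdot> canonical)"
    by (metis to_real_canonical to_real_intersection)
  moreover have "(of_int z :: real) = -1 \<longleftrightarrow> z = -1" for z
    by linarith
  ultimately show ?thesis
    by (simp add: lines_def to_real_intersection)
qed

section \<open>Linear symmetries act on the faces of the polytope\<close>

text \<open>An involution is its own inverse, so it permutes any class of faces that it sends into
  itself. The class \<open>P\<close> is kept abstract because simplexes and crosspolytopes differ only in
  the reason for their stability.\<close>

lemma acts_on_faces:
  assumes "linear g" and invol: "\<And>D. g (g D) = D"
    and poly: "g ` gosset_polytope = gosset_polytope"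
    and stable: "\<And>S. P S \<Longrightarrow> P (g ` S)"
  shows "acts_on g {F. F face_of gosset_polytope \<and> P F}"
proof -
  have "inj g"
    by (metis injI invol)
  have "g ` F face_of gosset_polytope" if "F face_of gosset_polytope" for F
    using face_of_linear_image[OF \<open>linear g\<close> \<open>inj g\<close>, of F gosset_polytope] that poly by simp
  moreover have "g ` g ` F = F" for F
    by (simp add: image_image invol)
  ultimately show ?thesis
    unfolding acts_on_def using stable
    by (intro bij_betw_byWitness[where f' = "\<lambda>F. g ` F"]) auto
qed

lemma gosset_dist_linear_isometry:
  assumes "linear g" and "\<And>D E. g D \<cdot> g E = D \<cdot> E"
  shows "gosset_dist (g x) (g y) = gosset_dist x y"
  using assms by (simp add: gosset_dist_def flip: linear_diff[OF \<open>linear g\<close>])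

lemma affine_dependent_injective_linear_image:
  fixes f :: "'a::euclidean_space \<Rightarrow> 'b::euclidean_space"
  assumes "linear f" and "inj f"
  shows "affine_dependent (f ` C) \<longleftrightarrow> affine_dependent C"
proof -
  have "f ` (affine hull (C - {x})) = affine hull (f ` C - {f x})" for x
    using assms by (simp add: affine_hull_linear_image linear_conv_bounded_linear image_set_diff)
  from this[symmetric] show ?thesis
    by (simp add: affine_dependent_def inj_image_mem_iff[OF \<open>inj f\<close>])
qed

lemma regular_simplex_linear_image:
  assumes "linear g" and "inj g" and isometry: "\<And>D E. g D \<cdot> g E = D \<cdot> E"
    and "regular_simplex k S"
  shows "regular_simplex k (g ` S)"
proof -
  obtain C s where C: "\<not> affine_dependent C" "card C = k + 1" "S = convex hull C"
    and s: "\<forall>x\<in>C. \<forall>y\<in>C. x \<noteq> y \<longrightarrow> gosset_dist x y = s"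
    using assms(4) unfolding regular_simplex_def by blast
  have "\<not> affine_dependent (g ` C)"
    using C(1) by (simp add: affine_dependent_injective_linear_image[OF \<open>linear g\<close> \<open>inj g\<close>])
  moreover have "card (g ` C) = k + 1"
    using C(2) card_image[OF inj_on_subset[OF \<open>inj g\<close>], of C] by simp
  moreover have "g ` S = convex hull (g ` C)"
    using C(3) convex_hull_linear_image[OF \<open>linear g\<close>] by simp
  moreover have "\<forall>x\<in>g ` C. \<forall>y\<in>g ` C. x \<noteq> y \<longrightarrow> gosset_dist x y = s"
    using s gosset_dist_linear_isometry[OF \<open>linear g\<close> isometry] by auto
  ultimately show ?thesis
    unfolding regular_simplex_def by blast
qed

lemma regular_crosspolytope_linear_image:
  assumes "linear g" and isometry: "\<And>D E. g D \<cdot> g E = D \<cdot> E"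
    and "regular_crosspolytope n S"
  shows "regular_crosspolytope n (g ` S)"
proof -
  obtain c v s where "s > 0" and orth: "\<forall>i<n. \<forall>j<n. - (v i \<cdot> v j) = (if i = j then s else 0)"
    and S: "S = convex hull ((\<lambda>i. c + v i) ` {..<n} \<union> (\<lambda>i. c - v i) ` {..<n})"
    using assms(3) unfolding regular_crosspolytope_def by blast
  have "g ` S = convex hull ((\<lambda>i. g c + g (v i)) ` {..<n} \<union> (\<lambda>i. g c - g (v i)) ` {..<n})"
    by (simp add: S convex_hull_linear_image[OF \<open>linear g\<close>] image_Un image_image
        linear_add[OF \<open>linear g\<close>] linear_diff[OF \<open>linear g\<close>])
  with \<open>s > 0\<close> orth show ?thesis
    unfolding regular_crosspolytope_def
    by (intro exI[of _ "g c"] exI[of _ "\<lambda>i. g (v i)"] exI[of _ s]) (simp add: isometry)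
qed

lemma acts_on_gosset_simplexes:
  assumes "linear g" and "\<And>D. g (g D) = D" and "\<And>D E. g D \<cdot> g E = D \<cdot> E"
    and "g ` gosset_polytope = gosset_polytope"
  shows "acts_on g (gosset_simplexes k)"
proof -
  have "inj g"
    by (metis injI assms(2))
  then show ?thesis
    unfolding gosset_simplexes_def
    using assms by (intro acts_on_faces regular_simplex_linear_image)
qed

lemma acts_on_gosset_crosspolytopes:
  assumes "linear g" and "\<And>D. g (g D) = D" and "\<And>D E. g D \<cdot> g E = D \<cdot> E"
    and "g ` gosset_polytope = gosset_polytope"
  shows "acts_on g (gosset_crosspolytopes n)"
  unfolding gosset_crosspolytopes_def
  using assms by (intro acts_on_faces regular_crosspolytope_linear_image)

section \<open>The involution fixing the canonical class\<close>

text \<open>The negative of the reflection in the hyperplane orthogonal to the canonical class.\<close>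

definition canonical_involution :: "(real, 'r::finite) pic \<Rightarrow> (real, 'r) pic" where
  "canonical_involution D =
    (2 * (D \<cdot> canonical) / ((canonical :: (real, 'r) pic) \<cdot> canonical)) *\<^sub>R canonical - D"

lemma linear_canonical_involution: "linear canonical_involution"
  by (rule linearI)
    (simp_all add: canonical_involution_def intersection_add_left intersection_scaleR_left
      algebra_simps add_divide_distrib)

lemma canonical_involution_intersection_canonical:
  assumes "(canonical :: (real, 'r::finite) pic) \<cdot> canonical \<noteq> 0"
  shows "canonical_involution D \<cdot> (canonical :: (real, 'r) pic) = D \<cdot> canonical"
  using assms
  by (simp add: canonical_involution_def intersection_diff_left intersection_scaleR_left)

lemma canonical_involution_isometry:
  fixes D E :: "(real, 'r::finite) pic"
  assumes "(canonical :: (real, 'r) pic) \<cdot> canonical \<noteq> 0"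
  shows "canonical_involution D \<cdot> canonical_involution E = D \<cdot> E"
  using assms
  by (simp add: canonical_involution_def intersection_diff_left intersection_diff_right
      intersection_scaleR_left intersection_scaleR_right intersection_commute[of canonical E])

lemma canonical_involution_involutive:
  fixes D :: "(real, 'r::finite) pic"
  assumes "(canonical :: (real, 'r) pic) \<cdot> canonical \<noteq> 0"
  shows "canonical_involution (canonical_involution D) = D"
proof -
  have "canonical_involution (canonical_involution D) =
      (2 * (D \<cdot> canonical) / ((canonical :: (real, 'r) pic) \<cdot> canonical)) *\<^sub>R canonical
        - canonical_involution D"
    using canonical_involution_intersection_canonical[OF assms, of D]
    by (simp add: canonical_involution_def[of "canonical_involution D"])
  then show ?thesis
    by (simp add: canonical_involution_def)
qed

lemma canonical_involution_line:
  fixes l :: "(int, 'r::finite) pic"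
  assumes "l \<in> lines"
  shows "canonical_involution (to_real l) =
    - ((2 / (9 - of_nat CARD('r))) *\<^sub>R canonical + to_real l)"
  using assms by (simp add: lines_iff_to_real canonical_involution_def canonical_self_intersection)

text \<open>The hypothesis on \<open>T\<close> says that the involution takes integral values on the lines. That
  suffices: the images are then lines, and an involution which maps a set into itself maps it
  onto itself.\<close>

lemma canonical_involution_image_lines:
  fixes T :: "(int, 'r::finite) pic \<Rightarrow> (int, 'r) pic"
  assumes K: "(canonical :: (real, 'r) pic) \<cdot> canonical \<noteq> 0"
    and T: "\<And>l. l \<in> lines \<Longrightarrow> to_real (T l) = canonical_involution (to_real l)"
  shows "canonical_involution ` to_real ` (lines :: (int, 'r) pic set) = to_real ` lines"
proof -
  have "T l \<in> lines" if "l \<in> lines" for l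
    using that
    by (simp add: lines_iff_to_real T[OF that] canonical_involution_isometry[OF K]
        canonical_involution_intersection_canonical[OF K])
  then have into: "canonical_involution ` to_real ` lines \<subseteq> to_real ` (lines :: (int, 'r) pic set)"
    using T by (force simp flip: T)
  show ?thesis
  proof
    show "to_real ` (lines :: (int, 'r) pic set) \<subseteq> canonical_involution ` to_real ` lines"
      using image_mono[OF into, of canonical_involution]
      by (simp add: image_image canonical_involution_involutive[OF K])
  qed (rule into)
qed

lemma canonical_involution_symmetry:
  fixes T :: "(int, 'r::finite) pic \<Rightarrow> (int, 'r) pic"
  assumes K: "(canonical :: (real, 'r) pic) \<cdot> canonical \<noteq> 0"
    and T: "\<And>l. l \<in> lines \<Longrightarrow> to_real (T l) = canonical_involution (to_real l)"
  shows "gosset_symmetry (canonical_involution :: (real, 'r) pic \<Rightarrow> _)"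
proof -
  let ?g = "canonical_involution :: (real, 'r) pic \<Rightarrow> _"
  have sub: "?g ` gosset_space \<subseteq> gosset_space"
    by (auto simp: gosset_space_def canonical_involution_intersection_canonical[OF K])
  have "gosset_space \<subseteq> ?g ` gosset_space"
    using image_mono[OF sub, of ?g] by (simp add: image_image canonical_involution_involutive[OF K])
  moreover have "?g ` gosset_polytope = gosset_polytope"
    unfolding gosset_polytope_def
    by (simp add: convex_hull_linear_image[OF linear_canonical_involution]
        canonical_involution_image_lines[OF K T])
  ultimately show ?thesis
    unfolding gosset_symmetry_def
    using sub gosset_dist_linear_isometry[OF linear_canonical_involution
        canonical_involution_isometry[OF K]] by auto
qed

lemma canonical_involution_extends:
  assumes "\<And>l. l \<in> lines \<Longrightarrow> to_real (T l) = canonical_involution (to_real l)"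
  shows "extends_linearly T canonical_involution"
  unfolding extends_linearly_def
  using assms
  by (auto simp: linear_sum[OF linear_canonical_involution]
      linear_scale[OF linear_canonical_involution] subset_iff intro!: sum.cong)

lemma canonical_involution_extension_acts:
  fixes T :: "(int, 'r::finite) pic \<Rightarrow> (int, 'r) pic"
  assumes K: "(canonical :: (real, 'r) pic) \<cdot> canonical \<noteq> 0"
    and T: "\<And>l. l \<in> lines \<Longrightarrow> to_real (T l) = canonical_involution (to_real l)"
  shows "extends_linearly T canonical_involution \<and>
    gosset_symmetry (canonical_involution :: (real, 'r) pic \<Rightarrow> _) \<and>
    (\<forall>k\<le>m. acts_on (canonical_involution :: (real, 'r) pic \<Rightarrow> _) (gosset_simplexes k)) \<and>
    acts_on (canonical_involution :: (real, 'r) pic \<Rightarrow> _) (gosset_crosspolytopes n)"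
proof -
  have sym: "gosset_symmetry (canonical_involution :: (real, 'r) pic \<Rightarrow> _)"
    by (rule canonical_involution_symmetry[OF K T])
  then have "canonical_involution ` gosset_polytope = (gosset_polytope :: (real, 'r) pic set)"
    by (simp add: gosset_symmetry_def)
  note automorphism = linear_canonical_involution canonical_involution_involutive[OF K]
    canonical_involution_isometry[OF K] this
  show ?thesis
    using sym canonical_involution_extends[of T, OF T] acts_on_gosset_simplexes[OF automorphism]
      acts_on_gosset_crosspolytopes[OF automorphism] by blast
qed

lemma gieser_eq_canonical_involution:
  "l \<in> lines \<Longrightarrow> to_real (gieser l) = canonical_involution (to_real l)"
  by (simp add: canonical_involution_line gieser_def to_real_minus to_real_add to_real_canonical
      del: minus_add_distrib)

lemma bertini_eq_canonical_involution:
  "l \<in> lines \<Longrightarrow> to_real (bertini l) = canonical_involution (to_real l)"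
  by (simp add: canonical_involution_line bertini_def to_real_minus to_real_add to_real_canonical
      scaleR_2 del: minus_add_distrib)

theorem theorem18:
  shows "(\<exists>g :: (real, 7) pic \<Rightarrow> (real, 7) pic.
           extends_linearly gieser g \<and>
           gosset_symmetry g \<and>
           (\<forall>k\<le>6. acts_on g (gosset_simplexes k)) \<and>
           acts_on g (gosset_crosspolytopes 6)) \<and>
         (\<exists>b :: (real, 8) pic \<Rightarrow> (real, 8) pic.
           extends_linearly bertini b \<and>
           gosset_symmetry b \<and>
           (\<forall>k\<le>7. acts_on b (gosset_simplexes k)) \<and>
           acts_on b (gosset_crosspolytopes 7))"
proof -
  have "(canonical :: (real, 7) pic) \<cdot> canonical \<noteq> 0" "(canonical :: (real, 8) pic) \<cdot> canonical \<noteq> 0"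
    by (simp_all add: canonical_self_intersection)
  from canonical_involution_extension_acts[OF this(1) gieser_eq_canonical_involution, of 6 6]
    canonical_involution_extension_acts[OF this(2) bertini_eq_canonical_involution, of 7 7]
  show ?thesis
    by blast
qed

end
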